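(* Consider a hereditary $\mathscr{B}$-free subshift $(X_\eta,S)$. Assume that a cellular automaton $\tau$ on $(X_\eta,S)$ is surjective and that $\tau(0^{-\mathbb{N}}10^{\mathbb{N}})\neq 0^{\mathbb{Z}}$. Then $\tau$ is a power of the shift, i.e., $\tau=S^t$ for some $t\in\mathbb{Z}$. In particular, $(X_\eta,S)$ satisfies the Moore property.
   Context: $\mathscr{B}\subset\mathbb{N}=\{1,2,\dots\}$ is assumed primitive (no element of $\mathscr{B}$ divides another element of $\mathscr{B}$) and $\mathscr{B}\neq\{1\}$. Put $\mathcal{F}_{\mathscr{B}}=\mathbb{Z}\setminus\bigcup_{b\in\mathscr{B}}b\mathbb{Z}$ and let $\eta\in\{0,1\}^{\mathbb{Z}}$ be its characteristic function. Let $S$ be the left shift on $\{0,1\}^{\mathbb{Z}}$ (product topology), $(Sx)(j)=x(j+1)$. The $\mathscr{B}$-free subshift is $(X_\eta,S)$ with $X_\eta=\overline{\{S^r\eta: r\in\mathbb{Z}\}}$. It is hereditary if $y\in X_\eta$ whenever $y\in\{0,1\}^{\mathbb{Z}}$ and $y\le x$ coordinatewise for some $x\in X_\eta$. $0^{\mathbb{Z}}$ denotes the all-zero sequence, and $0^{-\mathbb{N}}10^{\mathbb{N}}$ denotes the sequence $u\in\{0,1\}^{\mathbb{Z}}$ with $u(0)=1$ and $u(n)=0$ for all $n\neq 0$; by heredity both belong to $X_\eta$. A cellular automaton (CA) on a subshift $(X,S)$ is an endomorphism of $(X,S)$, i.e., a continuous map $\tau:X\to X$ commuting with $S$. It is pre-injective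 if for any $x,y\in X$, $\tau(x)=\tau(y)$ implies that either $x=y$ or $x$ and $y$ differ at infinitely many coordinates. A subshift satisfies the Moore property if every surjective CA on it is pre-injective. *)

theory Defs
  imports "HOL-Analysis.Analysis"
begin

text \<open>
  The alphabet $\{0,1\}$ is the type \<^typ>\<open>bool\<close>, with \<^term>\<open>True\<close> for 1 and \<^term>\<open>False\<close> for 0.
  The library topology on \<^typ>\<open>bool\<close> is discrete and the one on \<^typ>\<open>int \<Rightarrow> bool\<close> is the product
  topology, so \<^const>\<open>closure\<close> and \<^const>\<open>continuous_on\<close> below refer to the usual topology of the
  full shift.
\<close>

type_synonym bseq = "int \<Rightarrow> bool"

definition shift :: "bseq \<Rightarrow> bseq" where
  "shift x = (\<lambda>j. x (j + 1))"

definition shift_power :: "int \<Rightarrow> bseq \<Rightarrow> bseq" where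
  "shift_power t = (if 0 \<le> t then shift ^^ nat t else inv shift ^^ nat (- t))"

definition primitive_set :: "nat set \<Rightarrow> bool" where
  "primitive_set B \<longleftrightarrow> (\<forall>a\<in>B. \<forall>b\<in>B. a dvd b \<longrightarrow> a = b)"

definition free_integers :: "nat set \<Rightarrow> int set" where
  "free_integers B = UNIV - (\<Union>b\<in>B. {int b * k |k. True})"

definition eta :: "nat set \<Rightarrow> bseq" where
  "eta B = (\<lambda>n. n \<in> free_integers B)"

definition free_subshift :: "nat set \<Rightarrow> bseq set" where
  "free_subshift B = closure {shift_power r (eta B) |r. True}"

text \<open>The order on \<^typ>\<open>bool\<close> is \<^prop>\<open>False \<le> True\<close>, so the hypothesis on \<open>y\<close> is $y \le x$
  coordinatewise.\<close>

definition hereditary :: "bseq set \<Rightarrow> bool" where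
  "hereditary X \<longleftrightarrow> (\<forall>x\<in>X. \<forall>y. (\<forall>j. y j \<le> x j) \<longrightarrow> y \<in> X)"

definition zero_seq :: bseq where
  "zero_seq = (\<lambda>n. False)"

definition single_one :: bseq where
  "single_one = (\<lambda>n. n = 0)"

text \<open>
  A map on a subshift \<open>X\<close> is represented by a function on the whole of \<^typ>\<open>bseq\<close>; its values
  outside \<open>X\<close> are irrelevant to all notions below.
\<close>

definition cellular_automaton :: "bseq set \<Rightarrow> (bseq \<Rightarrow> bseq) \<Rightarrow> bool" where
  "cellular_automaton X \<tau> \<longleftrightarrow>
     \<tau> ` X \<subseteq> X \<and> continuous_on X \<tau> \<and> (\<forall>x\<in>X. \<tau> (shift x) = shift (\<tau> x))"

definition surjective_on :: "bseq set \<Rightarrow> (bseq \<Rightarrow> bseq) \<Rightarrow> bool" where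
  "surjective_on X \<tau> \<longleftrightarrow> \<tau> ` X = X"

definition pre_injective :: "bseq set \<Rightarrow> (bseq \<Rightarrow> bseq) \<Rightarrow> bool" where
  "pre_injective X \<tau> \<longleftrightarrow>
     (\<forall>x\<in>X. \<forall>y\<in>X. \<tau> x = \<tau> y \<longrightarrow> x = y \<or> infinite {n. x n \<noteq> y n})"

definition moore_property :: "bseq set \<Rightarrow> bool" where
  "moore_property X \<longleftrightarrow>
     (\<forall>\<tau>. cellular_automaton X \<tau> \<and> surjective_on X \<tau> \<longrightarrow> pre_injective X \<tau>)"

lemma funpow_shift: "(shift ^^ n) x = (\<lambda>j. x (j + int n))"
  by (induction n) (auto simp: shift_def algebra_simps)

lemma inv_shift: "inv shift = (\<lambda>x j. x (j - 1))"
  by (rule inv_equality) (auto simp: shift_def)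

lemma funpow_inv_shift: "(inv shift ^^ n) x = (\<lambda>j. x (j - int n))"
  by (induction n) (auto simp: inv_shift algebra_simps)

lemma shift_power_apply: "shift_power t x = (\<lambda>j. x (j + t))"
  by (auto simp: shift_power_def funpow_shift funpow_inv_shift)

end

theory Submission
  imports Defs
begin

text \<open>
  Write \<open>F\<close> for the \<open>\<B>\<close>-free integers and fix \<open>b \<in> B\<close>. By heredity a finite pattern belongs to the
  subshift iff some translate of it is contained in \<open>F\<close>, so no point of the subshift meets more
  residue classes modulo \<open>b\<close> than \<open>F\<close> does. Combining far apart translates by multiples of \<open>b\<close>, one
  sees that the images under a surjective automaton \<open>\<tau>\<close> of all finite subsets of \<open>F\<close> together fill
  exactly the classes of \<open>F + c\<close>, with \<open>c\<close> unique modulo \<open>b\<close>.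

  If \<open>c\<close> is \<open>0\<close> for every \<open>b\<close>, then \<open>\<tau>\<close> maps subsets of \<open>F\<close> to subsets of \<open>F\<close>. As every finite pattern
  occurs in \<open>F\<close> as an exact window, this gives \<open>\<tau> x \<le> x\<close>; by maximality of \<open>\<eta>\<close> the only preimage of
  \<open>\<eta>\<close> is \<open>\<eta>\<close>, hence \<open>\<tau>\<close> is the identity.

  If \<open>\<tau>\<close> maps the single one to a sequence with a one at \<open>a\<close>, then \<open>c = a\<close> for every \<open>b\<close>, and \<open>\<tau>\<close>
  is a shift by the previous case. In general, conjugating \<open>\<tau>\<close> by the reflection \<open>j \<mapsto> - j\<close> replaces
  \<open>c\<close> by \<open>- c\<close>, so the composition of both automata is the identity and \<open>\<tau>\<close> is injective.
\<close>

subsection \<open>Topology of the full shift\<close>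

lemma open_window: "open {y :: bseq. \<forall>j. \<bar>j\<bar> \<le> n \<longrightarrow> y j = x j}"
proof -
  have "open {y :: bseq. \<forall>j\<in>{-n..n}. y (id j) \<in> {x j}}"
    by (rule product_topology_basis') (auto intro: open_discrete)
  also have "{y :: bseq. \<forall>j\<in>{-n..n}. y (id j) \<in> {x j}} = {y. \<forall>j. \<bar>j\<bar> \<le> n \<longrightarrow> y j = x j}"
    by (auto simp: abs_le_iff minus_le_iff)
  finally show ?thesis .
qed

lemma open_contains_window:
  assumes "open U" "(x :: bseq) \<in> U"
  obtains n where "\<And>y. (\<And>j. \<bar>j\<bar> \<le> n \<Longrightarrow> y j = x j) \<Longrightarrow> y \<in> U"
proof -
  obtain V where V: "x \<in> (\<Pi>\<^sub>E i\<in>UNIV. V i)" "finite {i. V i \<noteq> UNIV}" "(\<Pi>\<^sub>E i\<in>UNIV. V i) \<subseteq> U"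
    using product_topology_open_contains_basis[of "\<lambda>_. euclidean" UNIV U x] assms
    by (auto simp: open_fun_def)
  show ?thesis
  proof
    \<comment> \<open>Only finitely many coordinates are constrained by a basic open set. The
      inserted 0 keeps \<open>Max\<close> meaningful when there are none.\<close>
    fix y assume y: "\<And>j. \<bar>j\<bar> \<le> Max (insert 0 (abs ` {i. V i \<noteq> UNIV})) \<Longrightarrow> y j = x j"
    have "y i \<in> V i" for i
    proof (cases "V i = UNIV")
      case False
      then have "\<bar>i\<bar> \<le> Max (insert 0 (abs ` {i. V i \<noteq> UNIV}))"
        using V(2) by (intro Max_ge) auto
      then show ?thesis using y V(1) by (auto simp: PiE_def Pi_def)
    qed simp
    then show "y \<in> U" using V(3) by (auto simp: PiE_def)
  qed
qed

lemma closure_windows: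
  fixes S :: "bseq set"
  shows "x \<in> closure S \<longleftrightarrow> (\<forall>n. \<exists>y\<in>S. \<forall>j. \<bar>j\<bar> \<le> n \<longrightarrow> y j = x j)"
proof
  assume x: "x \<in> closure S"
  show "\<forall>n. \<exists>y\<in>S. \<forall>j. \<bar>j\<bar> \<le> n \<longrightarrow> y j = x j"
  proof
    fix n
    have "{y. \<forall>j. \<bar>j\<bar> \<le> n \<longrightarrow> y j = x j} \<inter> S \<noteq> {}"
      using x open_Int_closure_eq_empty[OF open_window[of n x], of S] by auto
    then show "\<exists>y\<in>S. \<forall>j. \<bar>j\<bar> \<le> n \<longrightarrow> y j = x j" by auto
  qed
next
  assume *: "\<forall>n. \<exists>y\<in>S. \<forall>j. \<bar>j\<bar> \<le> n \<longrightarrow> y j = x j"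
  show "x \<in> closure S"
  proof (rule ccontr)
    assume "x \<notin> closure S"
    then obtain n where n: "\<And>y. (\<And>j. \<bar>j\<bar> \<le> n \<Longrightarrow> y j = x j) \<Longrightarrow> y \<in> - closure S"
      using open_contains_window[of "- closure S" x] by (auto simp: open_Compl)
    obtain y where "y \<in> S" "\<forall>j. \<bar>j\<bar> \<le> n \<longrightarrow> y j = x j" using * by blast
    with n[of y] closure_subset[of S] show False by auto
  qed
qed

lemma compact_UNIV_bseq: "compact (UNIV :: bseq set)"
proof -
  have "compact (UNIV :: bool set)" by (simp add: finite_imp_compact)
  then have "compactin euclidean (UNIV :: bool set)" by (simp only: compactin_euclidean_iff)
  then have "compact_space (euclidean :: bool topology)" by (simp only: compact_space_def topspace_euclidean)
  then have "compact_space (product_topology (\<lambda>_ :: int. euclidean :: bool topology) UNIV)"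
    unfolding compact_space_product_topology by blast
  then have "compactin euclidean (UNIV :: bseq set)"
    by (simp add: euclidean_product_topology compact_space_def)
  then show ?thesis by (simp only: compactin_euclidean_iff)
qed

text \<open>The locality half of the Curtis-Hedlund-Lyndon theorem: continuity gives each point its
  own radius, and compactness of \<open>X\<close> leaves only finitely many radii to
  dominate.\<close>

lemma uniformly_local:
  assumes "closed X" "continuous_on X (\<tau> :: bseq \<Rightarrow> bseq)"
  obtains N where "\<And>x y. x \<in> X \<Longrightarrow> y \<in> X \<Longrightarrow> (\<And>j. \<bar>j\<bar> \<le> N \<Longrightarrow> x j = y j) \<Longrightarrow> \<tau> x 0 = \<tau> y 0"
proof -
  have "\<exists>n. \<forall>y\<in>X. (\<forall>j. \<bar>j\<bar> \<le> n \<longrightarrow> y j = x j) \<longrightarrow> \<tau> y 0 = \<tau> x 0" if x: "x \<in> X" for x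
  proof -
    have "open {z :: bseq. z 0 = \<tau> x 0}" using open_window[of 0 "\<tau> x"] by simp
    moreover have "\<tau> x \<in> {z. z 0 = \<tau> x 0}" by simp
    ultimately have "\<exists>A. open A \<and> x \<in> A \<and> (\<forall>y\<in>X. y \<in> A \<longrightarrow> \<tau> y \<in> {z. z 0 = \<tau> x 0})"
      using assms(2)[unfolded continuous_on_topological] x by (simp only: Ball_def)
    then obtain A where A: "open A" "x \<in> A" "\<And>y. y \<in> X \<Longrightarrow> y \<in> A \<Longrightarrow> \<tau> y 0 = \<tau> x 0"
      by auto
    obtain n where "\<And>y. (\<And>j. \<bar>j\<bar> \<le> n \<Longrightarrow> y j = x j) \<Longrightarrow> y \<in> A"
      using open_contains_window[OF A(1,2)] by blast
    then show ?thesis using A(3) by blast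
  qed
  then have "\<forall>x\<in>X. \<exists>n. \<forall>y\<in>X. (\<forall>j. \<bar>j\<bar> \<le> n \<longrightarrow> y j = x j) \<longrightarrow> \<tau> y 0 = \<tau> x 0" ..
  from bchoice[OF this] obtain n
    where n: "\<forall>x\<in>X. \<forall>y\<in>X. (\<forall>j. \<bar>j\<bar> \<le> n x \<longrightarrow> y j = x j) \<longrightarrow> \<tau> y 0 = \<tau> x 0" ..
  define W where "W x = {y. \<forall>j. \<bar>j\<bar> \<le> n x \<longrightarrow> y j = x j}" for x
  have W: "open (W x)" "x \<in> W x" for x unfolding W_def using open_window by auto
  have "compact (UNIV \<inter> X)" by (rule compact_Int_closed[OF compact_UNIV_bseq assms(1)])
  then have "compact X" by simp
  moreover have "X \<subseteq> (\<Union>x\<in>X. W x)" using W(2) by blast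
  ultimately obtain D where D: "D \<subseteq> X" "finite D" "X \<subseteq> (\<Union>x\<in>D. W x)"
    using compactE_image[of X X W, OF _ W(1)] by metis
  show ?thesis
  proof
    fix x y assume xy: "x \<in> X" "y \<in> X" "\<And>j. \<bar>j\<bar> \<le> Max (insert 0 (n ` D)) \<Longrightarrow> x j = y j"
    obtain z where z: "z \<in> D" "\<forall>j. \<bar>j\<bar> \<le> n z \<longrightarrow> x j = z j"
      using D(3) xy(1) unfolding W_def by blast
    have "n z \<le> Max (insert 0 (n ` D))" using z(1) D(2) by (intro Max_ge) auto
    then have "\<forall>j. \<bar>j\<bar> \<le> n z \<longrightarrow> y j = z j" using xy(3) z(2) by fastforce
    moreover have "z \<in> X" using z(1) D(1) by blast
    ultimately show "\<tau> x 0 = \<tau> y 0" using n z(2) xy(1,2) by blast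
  qed
qed

subsection \<open>Residue classes of the \<open>\<B>\<close>-free integers\<close>

lemma free_integers_iff: "m \<in> free_integers B \<longleftrightarrow> (\<forall>b\<in>B. \<not> int b dvd m)"
  by (auto simp: free_integers_def dvd_def)

lemma eta_iff: "eta B j \<longleftrightarrow> j \<in> free_integers B"
  by (simp add: eta_def)

lemma free_integers_uminus: "- m \<in> free_integers B \<longleftrightarrow> m \<in> free_integers B"
  by (simp add: free_integers_iff)

definition residues :: "nat \<Rightarrow> int set \<Rightarrow> int set" where
  "residues b A = (\<lambda>m. m mod int b) ` A"

lemma finite_residues: "b > 0 \<Longrightarrow> finite (residues b A)"
  by (rule finite_subset[of _ "{0..<int b}"]) (auto simp: residues_def)

text \<open>Membership in the subshift only tests finite patterns, so infinite sets have to be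
  replaced by finite ones with the same residues.\<close>

lemma finite_representatives:
  assumes "b > 0"
  obtains C where "finite C" "C \<subseteq> A" "residues b C = residues b A"
  using finite_subset_image[OF finite_residues[OF assms], of A "\<lambda>m. m mod int b" A]
  unfolding residues_def by (metis order_refl)

lemma residues_translate: "residues b ((\<lambda>j. j + s) ` A) = (\<lambda>r. (r + s) mod int b) ` residues b A"
  by (simp add: residues_def image_image mod_add_left_eq)

lemma card_residues_translate: "card (residues b ((\<lambda>j. j + s) ` A)) = card (residues b A)"
proof -
  have "inj_on (\<lambda>r. (r + s) mod int b) (residues b A)"
  proof (rule inj_onI)
    fix r r' assume r: "r \<in> residues b A" "r' \<in> residues b A" "(r + s) mod int b = (r' + s) mod int b"
    then have "r mod int b = r' mod int b"
      by (simp add: mod_eq_dvd_iff)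
    then show "r = r'" using r(1,2) by (auto simp: residues_def)
  qed
  then show ?thesis by (simp add: residues_translate card_image)
qed

text \<open>If \<open>F\<close> were periodic modulo \<open>b\<close> with period \<open>k\<close>, then \<open>gcd k b\<close> would not be free, and
  primitivity would force the element of \<open>B\<close> dividing it to be \<open>b\<close>.\<close>

lemma period_free_residues:
  assumes "0 \<notin> B" "primitive_set B" "b \<in> B"
    and per: "\<And>q. q \<in> free_integers B \<Longrightarrow> (q + k) mod int b \<in> residues b (free_integers B)"
  shows "int b dvd k"
proof -
  let ?F = "free_integers B"
  have iter: "(q + int n * k) mod int b \<in> residues b ?F" if "q \<in> ?F" for q n
  proof (induction n)
    case 0
    then show ?case using that by (auto simp: residues_def)
  next
    case (Suc n)
    then obtain f where f: "f \<in> ?F" "(q + int n * k) mod int b = f mod int b"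
      by (auto simp: residues_def)
    then have "(q + int n * k + k) mod int b = (f + k) mod int b" by (metis mod_add_left_eq)
    then show ?case using per[OF f(1)] by (simp add: algebra_simps)
  qed
  have b: "b > 0" using assms(1,3) by (metis gr0I)
  obtain u v where uv: "u * k + v * int b = gcd k (int b)" using bezout_int by blast
  have "gcd k (int b) \<notin> ?F"
  proof
    assume "gcd k (int b) \<in> ?F"
    \<comment> \<open>The number of iterations is a nonnegative representative of \<open>- u\<close>
      modulo \<open>b\<close>, chosen so that the Bezout identity leads to the class of 0, which
      contains no element of \<open>F\<close>.\<close>
    then have "(gcd k (int b) + int (nat ((- u) mod int b)) * k) mod int b \<in> residues b ?F"
      by (rule iter)
    also have "(gcd k (int b) + int (nat ((- u) mod int b)) * k) mod int b
        = (gcd k (int b) + (- u) * k) mod int b"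
      using b by (simp add: mod_mult_left_eq mod_add_cong)
    also have "gcd k (int b) + (- u) * k = v * int b" using uv by (simp add: algebra_simps)
    finally obtain f where "f \<in> ?F" "f mod int b = 0" by (auto simp: residues_def)
    then show False using assms(3) by (auto simp: free_integers_iff)
  qed
  then obtain a where a: "a \<in> B" "int a dvd gcd k (int b)" by (auto simp: free_integers_iff)
  then have "a dvd b" by (metis gcd_dvd2 dvd_trans int_dvd_int_iff)
  then have "a = b" using assms(2,3) a(1) by (auto simp: primitive_set_def)
  then show ?thesis using a(2) by simp
qed

subsection \<open>Finite patterns of a hereditary subshift\<close>

definition ind :: "int set \<Rightarrow> bseq" where
  "ind C = (\<lambda>j. j \<in> C)"

lemma ind_translate: "ind ((\<lambda>j. j + s) ` C) = (\<lambda>j. ind C (j - s))"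
  by (auto simp: ind_def fun_eq_iff image_iff) (metis diff_add_cancel)

locale hereditary_free_subshift =
  fixes B :: "nat set"
  assumes zero_notin: "0 \<notin> B"
    and primitive: "primitive_set B"
    and not_one: "B \<noteq> {1}"
    and hered: "hereditary (free_subshift B)"
begin

abbreviation "F \<equiv> free_integers B"
abbreviation "X \<equiv> free_subshift B"

lemma X_windows: "x \<in> X \<longleftrightarrow> (\<forall>n. \<exists>r. \<forall>j. \<bar>j\<bar> \<le> n \<longrightarrow> x j = (j + r \<in> F))"
proof -
  have "x \<in> X \<longleftrightarrow> (\<forall>n. \<exists>r. \<forall>j. \<bar>j\<bar> \<le> n \<longrightarrow> shift_power r (eta B) j = x j)"
    unfolding free_subshift_def closure_windows by blast
  then show ?thesis unfolding shift_power_apply eta_iff by (simp only: eq_commute)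
qed

text \<open>The closure asks for windows of \<open>F\<close> that agree exactly. Once the ones of a
  window fit into \<open>F\<close> after a translation, heredity erases the surplus ones, so
  containment is enough.\<close>

lemma X_iff: "x \<in> X \<longleftrightarrow> (\<forall>C. finite C \<longrightarrow> (\<forall>j\<in>C. x j) \<longrightarrow> (\<exists>s. \<forall>j\<in>C. j + s \<in> F))"
proof
  assume x: "x \<in> X"
  show "\<forall>C. finite C \<longrightarrow> (\<forall>j\<in>C. x j) \<longrightarrow> (\<exists>s. \<forall>j\<in>C. j + s \<in> F)"
  proof (intro allI impI)
    fix C :: "int set" assume C: "finite C" "\<forall>j\<in>C. x j"
    obtain r where r: "\<forall>j. \<bar>j\<bar> \<le> Max (insert 0 (abs ` C)) \<longrightarrow> x j = (j + r \<in> F)"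
      using x X_windows by blast
    have "\<bar>j\<bar> \<le> Max (insert 0 (abs ` C))" if "j \<in> C" for j
      using C(1) that by (intro Max_ge) auto
    then show "\<exists>s. \<forall>j\<in>C. j + s \<in> F" using r C(2) by blast
  qed
next
  assume *: "\<forall>C. finite C \<longrightarrow> (\<forall>j\<in>C. x j) \<longrightarrow> (\<exists>s. \<forall>j\<in>C. j + s \<in> F)"
  show "x \<in> X"
    unfolding X_windows
  proof
    fix n
    let ?C = "{j. \<bar>j\<bar> \<le> n \<and> x j}"
    have "?C \<subseteq> {-n..n}" by auto
    then have "finite ?C" by (rule finite_subset) simp
    then obtain s where s: "\<forall>j\<in>?C. j + s \<in> F" using * by blast
    have "(\<lambda>j. j + s \<in> F) \<in> X" unfolding X_windows by blast
    then have "ind ?C \<in> X"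
      using hered s unfolding hereditary_def ind_def by (auto simp: le_bool_def)
    then obtain r where "\<forall>j. \<bar>j\<bar> \<le> n \<longrightarrow> ind ?C j = (j + r \<in> F)" using X_windows by blast
    then show "\<exists>r. \<forall>j. \<bar>j\<bar> \<le> n \<longrightarrow> x j = (j + r \<in> F)" by (auto simp: ind_def)
  qed
qed

lemma X_mono: "x \<in> X \<Longrightarrow> (\<And>j. y j \<Longrightarrow> x j) \<Longrightarrow> y \<in> X"
  using hered unfolding hereditary_def by (auto simp: le_bool_def)

lemma X_translate: "x \<in> X \<Longrightarrow> (\<lambda>j. x (j + r)) \<in> X"
  unfolding X_iff
proof (intro allI impI)
  fix C :: "int set" assume *: "\<forall>C. finite C \<longrightarrow> (\<forall>j\<in>C. x j) \<longrightarrow> (\<exists>s. \<forall>j\<in>C. j + s \<in> F)"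
    "finite C" "\<forall>j\<in>C. x (j + r)"
  from *(1)[rule_format, of "(\<lambda>j. j + r) ` C"] *(2,3)
  obtain s where "\<forall>j\<in>(\<lambda>j. j + r) ` C. j + s \<in> F" by auto
  then show "\<exists>s. \<forall>j\<in>C. j + s \<in> F" by (intro exI[of _ "r + s"]) (simp add: add.assoc)
qed

lemma X_reflect: "x \<in> X \<Longrightarrow> (\<lambda>j. x (- j)) \<in> X"
  unfolding X_iff
proof (intro allI impI)
  fix C :: "int set" assume *: "\<forall>C. finite C \<longrightarrow> (\<forall>j\<in>C. x j) \<longrightarrow> (\<exists>s. \<forall>j\<in>C. j + s \<in> F)"
    "finite C" "\<forall>j\<in>C. x (- j)"
  from *(1)[rule_format, of "uminus ` C"] *(2,3)
  obtain s where s: "\<forall>j\<in>uminus ` C. j + s \<in> F" by auto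
  have "j + (- s) \<in> F" if "j \<in> C" for j
    using s that free_integers_uminus[of "j + - s" B] by auto
  then show "\<exists>s. \<forall>j\<in>C. j + s \<in> F" by blast
qed

lemma eta_X: "eta B \<in> X"
  unfolding X_iff eta_iff by (metis add.right_neutral)

lemma ind_X: "C \<subseteq> F \<Longrightarrow> ind C \<in> X"
  by (rule X_mono[OF eta_X]) (auto simp: ind_def eta_iff)

lemma one_F: "1 \<in> F"
  unfolding free_integers_iff
proof
  fix b assume b: "b \<in> B"
  show "\<not> int b dvd 1"
  proof
    assume "int b dvd 1"
    then have "b = 1" by simp
    with b have "a = 1" if "a \<in> B" for a
      using primitive that unfolding primitive_set_def by (metis one_dvd)
    with b \<open>b = 1\<close> not_one show False by blast
  qed
qed

lemma B_pos: "b \<in> B \<Longrightarrow> b > 0"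
  using zero_notin by (metis gr0I)

lemma exact_window:
  assumes "x \<in> X"
  obtains s where "\<And>j. \<bar>j\<bar> \<le> n \<Longrightarrow> j + s \<in> F \<longleftrightarrow> x j"
  using assms X_windows by metis

text \<open>By heredity an isolated one occurs as an exact window. If \<open>F\<close> were bounded,
  a wide enough window of this kind would contain all of \<open>F\<close>, in particular the two
  distinct elements 1 and -1.\<close>

lemma infinite_F: "infinite F"
proof
  assume fin: "finite F"
  define K where "K = Max (abs ` F)"
  have K: "\<bar>j\<bar> \<le> K" if "j \<in> F" for j
    unfolding K_def using fin that by (intro Max_ge) auto
  have "ind {1} \<in> X" using one_F by (intro ind_X) auto
  then obtain s where s: "\<And>j. \<bar>j\<bar> \<le> 2 * K + 1 \<Longrightarrow> j + s \<in> F \<longleftrightarrow> ind {1} j"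
    using exact_window[where n = "2 * K + 1"] by metis
  have "K \<ge> 1" using K[OF one_F] by simp
  then have "1 + s \<in> F" using s[of 1] by (simp add: ind_def)
  then have "\<bar>s\<bar> \<le> K + 1" using K[of "1 + s"] by linarith
  then have "\<bar>1 - s\<bar> \<le> 2 * K + 1" "\<bar>- 1 - s\<bar> \<le> 2 * K + 1" using \<open>K \<ge> 1\<close> by linarith+
  then have "1 - s = 1" "- 1 - s = 1"
    using s[of "1 - s"] s[of "- 1 - s"] one_F free_integers_uminus[of 1 B] by (auto simp: ind_def)
  then show False by simp
qed

text \<open>Some exact window of \<open>F\<close> shows a translate of \<open>C\<close> and nothing
  else. If it were taken near the origin, it would also show the larger set
  \<open>D\<close>.\<close>

lemma far_translate:
  assumes "finite C" "C \<subseteq> F"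
  obtains s where "\<bar>s\<bar> > K" "\<And>j. j \<in> C \<Longrightarrow> j + s \<in> F"
proof -
  obtain D where D: "finite D" "D \<subseteq> F" "card D = Suc (card C)"
    using infinite_F by (metis infinite_arbitrarily_large)
  define n where "n = Max (insert 0 (abs ` (C \<union> D))) + \<bar>K\<bar>"
  have n: "\<bar>j\<bar> + \<bar>K\<bar> \<le> n" if "j \<in> C \<union> D" for j
    unfolding n_def using assms(1) D(1) that by (intro add_right_mono Max_ge) auto
  obtain s where s: "\<And>j. \<bar>j\<bar> \<le> n \<Longrightarrow> j + s \<in> F \<longleftrightarrow> ind C j"
    using exact_window[OF ind_X[OF assms(2)]] by metis
  have "\<bar>s\<bar> > K"
  proof (rule ccontr)
    assume "\<not> \<bar>s\<bar> > K"
    then have "\<bar>j - s\<bar> \<le> n" if "j \<in> D" for j using n[of j] that by auto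
    then have "(\<lambda>j. j - s) ` D \<subseteq> C" using s D(2) by (fastforce simp: ind_def)
    then have "card ((\<lambda>j. j - s) ` D) \<le> card C" using assms(1) by (rule card_mono[rotated])
    moreover have "card ((\<lambda>j. j - s) ` D) = card D" by (rule card_image) (auto simp: inj_on_def)
    ultimately show False using D(3) by simp
  qed
  moreover have "j + s \<in> F" if "j \<in> C" for j
    using s[of j] n[of j] that by (auto simp: ind_def)
  ultimately show ?thesis using that by blast
qed

text \<open>Finitely many positions represent all residues of \<open>x\<close>; they can be moved
  into \<open>F\<close>, and translation does not change the number of classes.\<close>

lemma card_residues_X:
  assumes "x \<in> X" "b \<in> B"
  shows "card (residues b {j. x j}) \<le> card (residues b F)"
proof -
  obtain C where C: "finite C" "C \<subseteq> {j. x j}" "residues b C = residues b {j. x j}"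
    using finite_representatives[OF B_pos[OF assms(2)]] .
  then obtain s where s: "\<forall>j\<in>C. j + s \<in> F" using assms(1) unfolding X_iff by blast
  have "residues b ((\<lambda>j. j + s) ` C) \<subseteq> residues b F" using s by (auto simp: residues_def)
  then have "card (residues b ((\<lambda>j. j + s) ` C)) \<le> card (residues b F)"
    by (rule card_mono[OF finite_residues[OF B_pos[OF assms(2)]]])
  then show ?thesis using C(3) by (simp add: card_residues_translate)
qed

lemma residues_F_not_dvd:
  assumes "m mod int b \<in> residues b F" "b \<in> B"
  shows "\<not> int b dvd m"
proof -
  obtain q where "q \<in> F" "m mod int b = q mod int b" using assms(1) by (auto simp: residues_def)
  then show ?thesis using assms(2) by (metis dvd_eq_mod_eq_0 free_integers_iff)
qed

lemma residues_F_uminus: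
  assumes "m mod int b \<in> residues b F"
  shows "(- m) mod int b \<in> residues b F"
proof -
  obtain q where q: "q \<in> F" "m mod int b = q mod int b" using assms by (auto simp: residues_def)
  then have "(- m) mod int b = (- q) mod int b" by (metis mod_minus_cong)
  moreover have "- q \<in> F" using q(1) by (simp add: free_integers_uminus)
  ultimately show ?thesis by (auto simp: residues_def)
qed

lemma period_dvd:
  "b \<in> B \<Longrightarrow> (\<And>q. q \<in> F \<Longrightarrow> (q + k) mod int b \<in> residues b F) \<Longrightarrow> int b dvd k"
  using period_free_residues[OF zero_notin primitive] by blast

text \<open>Adding to \<open>C\<close> representatives of all classes of \<open>F\<close> turns
  every translation that keeps the pattern in \<open>F\<close> into a period of \<open>F\<close>
  modulo \<open>b\<close>, so divisibility by \<open>b\<close> is automatic.\<close>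

lemma far_periodic_translate:
  assumes "finite C" "C \<subseteq> F" "b \<in> B"
  obtains s where "\<bar>s\<bar> > K" "int b dvd s" "\<And>j. j \<in> C \<Longrightarrow> j + s \<in> F"
proof -
  obtain R where R: "finite R" "R \<subseteq> F" "residues b R = residues b F"
    using finite_representatives[OF B_pos[OF assms(3)]] .
  have fin: "finite (C \<union> R)" and sub: "C \<union> R \<subseteq> F" using assms R by auto
  obtain s where s: "\<bar>s\<bar> > K" "\<And>j. j \<in> C \<union> R \<Longrightarrow> j + s \<in> F"
    using far_translate[OF fin sub] by metis
  have "(q + s) mod int b \<in> residues b F" if "q \<in> F" for q
  proof -
    have "q mod int b \<in> residues b R" using that R(3) by (simp add: residues_def)
    then obtain r where r: "r \<in> R" "q mod int b = r mod int b" by (auto simp: residues_def)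
    then have "(q + s) mod int b = (r + s) mod int b" by (metis mod_add_left_eq)
    then show ?thesis using s(2)[of r] r(1) by (auto simp: residues_def)
  qed
  then have "int b dvd s" by (rule period_dvd[OF assms(3)])
  then show ?thesis using that s by blast
qed

lemma pattern_occurs:
  assumes "x \<in> X" "finite C" "\<And>j. j \<in> C \<Longrightarrow> x j"
  obtains s where "(\<lambda>j. j + s) ` C \<subseteq> F"
proof -
  obtain s where "\<forall>j\<in>C. j + s \<in> F"
    using assms(1)[unfolded X_iff, rule_format, OF assms(2)] assms(3) by blast
  then show ?thesis by (intro that) auto
qed

end

subsection \<open>Block codes\<close>

text \<open>A sliding block code of radius \<open>N\<close>. The sign of \<open>N\<close> is left
  open, which explains the \<open>\<bar>N\<bar>\<close> in several window sizes.\<close>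

locale block_code = hereditary_free_subshift +
  fixes \<tau> :: "bseq \<Rightarrow> bseq" and N :: int
  assumes maps: "x \<in> X \<Longrightarrow> \<tau> x \<in> X"
    and equivariant: "x \<in> X \<Longrightarrow> \<tau> (\<lambda>j. x (j + r)) = (\<lambda>j. \<tau> x (j + r))"
    and local_zero: "x \<in> X \<Longrightarrow> y \<in> X \<Longrightarrow> (\<And>j. \<bar>j\<bar> \<le> N \<Longrightarrow> x j = y j) \<Longrightarrow> \<tau> x 0 = \<tau> y 0"
begin

lemma local_at:
  assumes "x \<in> X" "y \<in> X" "\<And>j. \<bar>j - m\<bar> \<le> N \<Longrightarrow> x j = y j"
  shows "\<tau> x m = \<tau> y m"
proof -
  have "\<tau> (\<lambda>j. x (j + m)) 0 = \<tau> (\<lambda>j. y (j + m)) 0"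
    using assms by (intro local_zero X_translate) auto
  then show ?thesis using assms(1,2) by (simp add: equivariant)
qed

lemma code_translate:
  assumes "ind C \<in> X"
  shows "\<tau> (ind ((\<lambda>j. j + s) ` C)) (m + s) = \<tau> (ind C) m"
proof -
  have "\<tau> (ind ((\<lambda>j. j + s) ` C)) = (\<lambda>j. \<tau> (ind C) (j - s))"
    unfolding ind_translate using equivariant[OF assms, of "- s"] by simp
  then show ?thesis by simp
qed

text \<open>\<open>D\<close> is moved so far that no window of radius \<open>N\<close> around the
  relevant positions meets both patterns. A multiple of \<open>b\<close> is used so that residues
  survive the move.\<close>

lemma combine_patterns:
  assumes "finite C" "C \<subseteq> F" "finite D" "D \<subseteq> F" "b \<in> B"
  obtains s where "int b dvd s" "(\<lambda>j. j + s) ` D \<subseteq> F"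
    "\<And>j. \<bar>j\<bar> \<le> K \<Longrightarrow> \<tau> (ind (C \<union> (\<lambda>j. j + s) ` D)) j = \<tau> (ind C) j"
    "\<And>j. \<bar>j\<bar> \<le> K \<Longrightarrow> \<tau> (ind (C \<union> (\<lambda>j. j + s) ` D)) (j + s) = \<tau> (ind D) j"
proof -
  define A where "A = Max (insert 0 (abs ` (C \<union> D)))"
  have A: "\<bar>j\<bar> \<le> A" if "j \<in> C \<union> D" for j
    unfolding A_def using assms(1,3) that by (intro Max_ge) auto
  obtain s where s: "\<bar>s\<bar> > A + \<bar>K\<bar> + \<bar>N\<bar>" "int b dvd s" "\<And>j. j \<in> D \<Longrightarrow> j + s \<in> F"
    using far_periodic_translate[OF assms(3-5)] by metis
  let ?D = "(\<lambda>j. j + s) ` D"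
  have D: "?D \<subseteq> F" using s(3) by auto
  have "\<tau> (ind (C \<union> ?D)) j = \<tau> (ind C) j" if "\<bar>j\<bar> \<le> K" for j
  proof (rule local_at)
    fix i assume i: "\<bar>i - j\<bar> \<le> N"
    have "i \<notin> ?D" using A s(1) i that by fastforce
    then show "ind (C \<union> ?D) i = ind C i" by (simp add: ind_def)
  qed (use assms D in \<open>auto intro!: ind_X\<close>)
  moreover have "\<tau> (ind (C \<union> ?D)) (j + s) = \<tau> (ind D) j" if "\<bar>j\<bar> \<le> K" for j
  proof -
    have "\<tau> (ind (C \<union> ?D)) (j + s) = \<tau> (ind ?D) (j + s)"
    proof (rule local_at)
      fix i assume i: "\<bar>i - (j + s)\<bar> \<le> N"
      have "i \<notin> C" using A[of i] s(1) i that by fastforce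
      then show "ind (C \<union> ?D) i = ind ?D i" by (simp add: ind_def)
    qed (use assms D in \<open>auto intro!: ind_X\<close>)
    also have "\<dots> = \<tau> (ind D) j" by (rule code_translate[OF ind_X[OF assms(4)]])
    finally show ?thesis .
  qed
  ultimately show ?thesis using that s(2) D by blast
qed

section \<open>Residue classes reached by images of finite subsets of \<open>F\<close>\<close>

definition image_residues :: "nat \<Rightarrow> int set" where
  "image_residues b = {m mod int b | m C. finite C \<and> C \<subseteq> F \<and> \<tau> (ind C) m}"

lemma image_residuesI: "finite C \<Longrightarrow> C \<subseteq> F \<Longrightarrow> \<tau> (ind C) m \<Longrightarrow> m mod int b \<in> image_residues b"
  by (auto simp: image_residues_def)

text \<open>Each step of the induction adds a far away pattern that produces one more class. Keeping
  the image on a prescribed window lets classes be added without disturbing a value under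
  study.\<close>

lemma collect_image_residues:
  assumes "finite C" "C \<subseteq> F" "b \<in> B" "finite T" "T \<subseteq> image_residues b"
  shows "\<exists>D. finite D \<and> D \<subseteq> F \<and> (\<forall>j. \<bar>j\<bar> \<le> K \<longrightarrow> \<tau> (ind D) j = \<tau> (ind C) j)
    \<and> T \<subseteq> residues b {j. \<tau> (ind D) j}"
  using assms(4,5)
proof (induction T rule: finite_induct)
  case empty
  then show ?case using assms(1,2) by auto
next
  case (insert t T)
  then obtain D where D: "finite D" "D \<subseteq> F" "\<And>j. \<bar>j\<bar> \<le> K \<Longrightarrow> \<tau> (ind D) j = \<tau> (ind C) j"
      "T \<subseteq> residues b {j. \<tau> (ind D) j}"
    by auto
  obtain m E where E: "t = m mod int b" "finite E" "E \<subseteq> F" "\<tau> (ind E) m"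
    using insert.prems by (auto simp: image_residues_def)
  obtain W where W: "finite W" "W \<subseteq> {j. \<tau> (ind D) j}" "T = residues b W"
    using finite_subset_image[OF insert.hyps(1) D(4)[unfolded residues_def]]
    unfolding residues_def by blast
  \<comment> \<open>The protected window must cover the old window, the positions \<open>W\<close>
    that already realise \<open>T\<close>, and the position \<open>m\<close> that yields
    \<open>t\<close>.\<close>
  define K' where "K' = Max (insert \<bar>m\<bar> (insert K (abs ` W)))"
  have K': "\<bar>m\<bar> \<le> K'" "K \<le> K'" "\<And>j. j \<in> W \<Longrightarrow> \<bar>j\<bar> \<le> K'"
    unfolding K'_def using W(1) by (auto intro: Max_ge simp del: Max_insert)
  obtain s where s: "int b dvd s" "(\<lambda>j. j + s) ` E \<subseteq> F"
      "\<And>j. \<bar>j\<bar> \<le> K' \<Longrightarrow> \<tau> (ind (D \<union> (\<lambda>j. j + s) ` E)) j = \<tau> (ind D) j"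
      "\<And>j. \<bar>j\<bar> \<le> K' \<Longrightarrow> \<tau> (ind (D \<union> (\<lambda>j. j + s) ` E)) (j + s) = \<tau> (ind E) j"
    using combine_patterns[OF D(1,2) E(2,3) assms(3)] by metis
  let ?D = "D \<union> (\<lambda>j. j + s) ` E"
  have "\<tau> (ind ?D) (m + s)" using s(4)[OF K'(1)] E(4) by simp
  moreover have "t = (m + s) mod int b" using E(1) s(1) by (auto simp: dvd_def)
  ultimately have "t \<in> residues b {j. \<tau> (ind ?D) j}" by (auto simp: residues_def)
  moreover have "W \<subseteq> {j. \<tau> (ind ?D) j}" using W(2) K'(3) s(3) by auto
  then have "T \<subseteq> residues b {j. \<tau> (ind ?D) j}" unfolding W(3) residues_def by blast
  moreover have "\<tau> (ind ?D) j = \<tau> (ind C) j" if "\<bar>j\<bar> \<le> K" for j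
    using s(3)[of j] D(3)[OF that] K'(2) that by simp
  ultimately show ?case using D(1,2) E(2) s(2) by (intro exI[of _ ?D]) auto
qed

lemma finite_image_residues: "b \<in> B \<Longrightarrow> finite (image_residues b)"
  by (rule finite_subset[of _ "{0..<int b}"]) (auto simp: image_residues_def dest: B_pos)

text \<open>One finite \<open>D\<close> realises all image classes simultaneously, so the bound for
  a single point of \<open>X\<close> applies to \<open>\<tau> (ind D)\<close>.\<close>

lemma card_image_residues:
  assumes "b \<in> B"
  shows "card (image_residues b) \<le> card (residues b F)"
proof -
  obtain D where D: "finite D" "D \<subseteq> F" "image_residues b \<subseteq> residues b {j. \<tau> (ind D) j}"
    using collect_image_residues[OF finite.emptyI empty_subsetI assms finite_image_residues[OF assms]
        order_refl, of 0] by blast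
  have "card (image_residues b) \<le> card (residues b {j. \<tau> (ind D) j})"
    using D(3) finite_residues[OF B_pos[OF assms]] by (rule card_mono[rotated])
  also have "\<dots> \<le> card (residues b F)"
    by (rule card_residues_X[OF maps[OF ind_X[OF D(2)]] assms])
  finally show ?thesis .
qed

text \<open>By surjectivity the residues of images of patterns of \<open>F\<close> contain a translate of the residues
  of \<open>F\<close>, and by the previous count they cannot contain more.\<close>

lemma image_residues_eq:
  assumes surj: "\<tau> ` X = X" and "b \<in> B"
  obtains c where "image_residues b = (\<lambda>r. (r + c) mod int b) ` residues b F"
proof -
  obtain R where R: "finite R" "R \<subseteq> F" "residues b R = residues b F"
    using finite_representatives[OF B_pos[OF assms(2)]] .
  obtain x where x: "x \<in> X" "\<tau> x = eta B" using surj eta_X by (metis imageE)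
  \<comment> \<open>The window of radius \<open>n\<close> of the preimage \<open>x\<close>
    determines \<open>\<tau> x\<close> on \<open>R\<close>. The translation \<open>s\<close> that
    moves its ones into \<open>F\<close> then serves as \<open>c\<close>.\<close>
  define n where "n = Max (insert 0 (abs ` R)) + N"
  have n: "\<bar>j\<bar> + N \<le> n" if "j \<in> R" for j
    unfolding n_def using R(1) that by (intro add_right_mono Max_ge) auto
  let ?C = "{j. \<bar>j\<bar> \<le> n \<and> x j}"
  have "?C \<subseteq> {-n..n}" by auto
  then have C: "finite ?C" by (rule finite_subset) simp
  have CX: "ind ?C \<in> X" by (rule X_mono[OF x(1)]) (simp add: ind_def)
  obtain s where s: "(\<lambda>j. j + s) ` ?C \<subseteq> F" using pattern_occurs[OF x(1) C] by auto
  have "(r + s) mod int b \<in> image_residues b" if "r \<in> R" for r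
  proof (rule image_residuesI[OF finite_imageI[OF C] s])
    have "\<tau> (ind ?C) r = \<tau> x r"
    proof (rule local_at[OF CX x(1)])
      fix j assume "\<bar>j - r\<bar> \<le> N"
      then have "\<bar>j\<bar> \<le> n" using n[OF that] by linarith
      then show "ind ?C j = x j" by (simp add: ind_def)
    qed
    then show "\<tau> (ind ((\<lambda>j. j + s) ` ?C)) (r + s)"
      using x(2) R(2) that by (auto simp: code_translate[OF CX] eta_iff)
  qed
  then have "residues b ((\<lambda>j. j + s) ` R) \<subseteq> image_residues b" by (auto simp: residues_def)
  moreover have "card (image_residues b) \<le> card (residues b ((\<lambda>j. j + s) ` R))"
    using card_image_residues[OF assms(2)] R(3) by (simp add: card_residues_translate)
  ultimately have "residues b ((\<lambda>j. j + s) ` R) = image_residues b"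
    by (rule card_seteq[OF finite_image_residues[OF assms(2)]])
  then show ?thesis using that[of s] R(3) by (simp add: residues_translate)
qed

lemma image_residues_iff:
  assumes "\<tau> ` X = X" and "b \<in> B"
  obtains c where "\<And>m. m mod int b \<in> image_residues b \<longleftrightarrow> (m - c) mod int b \<in> residues b F"
proof -
  obtain c where c: "image_residues b = (\<lambda>r. (r + c) mod int b) ` residues b F"
    using image_residues_eq[OF assms] .
  have "m mod int b = (q mod int b + c) mod int b \<longleftrightarrow> (m - c) mod int b = q mod int b" for m q
  proof -
    have "m mod int b = (q mod int b + c) mod int b \<longleftrightarrow> m mod int b = (q + c) mod int b"
      by (simp add: mod_add_left_eq)
    also have "\<dots> \<longleftrightarrow> (m - c) mod int b = q mod int b"
      by (simp add: mod_eq_dvd_iff algebra_simps)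
    finally show ?thesis .
  qed
  then have "m mod int b \<in> image_residues b \<longleftrightarrow> (m - c) mod int b \<in> residues b F" for m
    unfolding c residues_def image_image image_iff by blast
  then show ?thesis by (rule that)
qed

section \<open>Automata that preserve the subsets of \<open>F\<close>\<close>

text \<open>The neighbourhood of \<open>m\<close> in \<open>x\<close> is found in \<open>F\<close>
  as an exact window. The hypothesis puts the translate of \<open>m\<close> into \<open>F\<close>,
  and exactness reads this back as a one of \<open>x\<close>.\<close>

lemma code_le:
  assumes pres: "\<And>C m. finite C \<Longrightarrow> C \<subseteq> F \<Longrightarrow> \<tau> (ind C) m \<Longrightarrow> m \<in> F"
    and x: "x \<in> X" and m: "\<tau> x m"
  shows "x m"
proof -
  let ?C = "{j. \<bar>j - m\<bar> \<le> \<bar>N\<bar> \<and> x j}"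
  have "?C \<subseteq> {m - \<bar>N\<bar>..m + \<bar>N\<bar>}" by auto
  then have C: "finite ?C" by (rule finite_subset) simp
  have CX: "ind ?C \<in> X" by (rule X_mono[OF x]) (simp add: ind_def)
  obtain s where s: "\<And>j. \<bar>j\<bar> \<le> \<bar>m\<bar> + \<bar>N\<bar> \<Longrightarrow> j + s \<in> F \<longleftrightarrow> ind ?C j"
    using exact_window[OF CX] by metis
  have "j + s \<in> F" if "j \<in> ?C" for j
  proof -
    have "\<bar>j\<bar> \<le> \<bar>m\<bar> + \<bar>N\<bar>" using that by auto
    then show ?thesis using s that by (simp add: ind_def)
  qed
  then have sub: "(\<lambda>j. j + s) ` ?C \<subseteq> F" by blast
  have "\<tau> (ind ?C) m = \<tau> x m"
    by (rule local_at[OF CX x]) (simp add: ind_def)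
  then have "\<tau> (ind ((\<lambda>j. j + s) ` ?C)) (m + s)" using m by (simp add: code_translate[OF CX])
  then have "m + s \<in> F" using pres[OF finite_imageI[OF C] sub] by blast
  then show "x m" using s[of m] by (simp add: ind_def)
qed

text \<open>A preimage of \<open>eta B\<close> lies above it, hence equals it by maximality. So
  \<open>\<tau>\<close> fixes all translates of \<open>eta B\<close>, whose windows exhaust those of
  \<open>X\<close>.\<close>

lemma code_eq_id:
  assumes pres: "\<And>C m. finite C \<Longrightarrow> C \<subseteq> F \<Longrightarrow> \<tau> (ind C) m \<Longrightarrow> m \<in> F"
    and surj: "\<tau> ` X = X" and "x \<in> X"
  shows "\<tau> x = x"
proof -
  obtain y where y: "y \<in> X" "\<tau> y = eta B" using surj eta_X by (metis imageE)
  have F_y: "y m" if "m \<in> F" for m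
    using code_le[OF pres y(1)] y(2) that by (simp add: eta_iff)
  have y_F: "m \<in> F" if "y m" for m
    unfolding free_integers_iff
  proof
    fix b assume b: "b \<in> B"
    \<comment> \<open>Maximality of \<open>eta B\<close>: a larger point of \<open>X\<close> has no
      room for a further class modulo \<open>b\<close>, in particular not for that of 0.\<close>
    have "residues b F \<subseteq> residues b {j. y j}" using F_y by (auto simp: residues_def)
    then have "residues b F = residues b {j. y j}"
      by (rule card_seteq[OF finite_residues[OF B_pos[OF b]] _ card_residues_X[OF y(1) b]])
    then have "m mod int b \<in> residues b F" using that by (auto simp: residues_def)
    then show "\<not> int b dvd m" using residues_F_not_dvd b by blast
  qed
  have "y = eta B" using F_y y_F by (auto simp: eta_iff fun_eq_iff)
  then have eta: "\<tau> (eta B) = eta B" using y(2) by simp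
  show ?thesis
  proof
    fix m
    obtain r where r: "\<And>j. \<bar>j\<bar> \<le> \<bar>m\<bar> + \<bar>N\<bar> \<Longrightarrow> j + r \<in> F \<longleftrightarrow> x j"
      using exact_window[OF assms(3)] by metis
    have "\<tau> x m = \<tau> (\<lambda>j. eta B (j + r)) m"
      using r by (intro local_at assms(3) X_translate eta_X) (auto simp: eta_iff)
    also have "\<dots> = eta B (m + r)" by (simp add: equivariant[OF eta_X] eta)
    also have "\<dots> = x m" using r[of m] by (simp add: eta_iff)
    finally show "\<tau> x m = x m" .
  qed
qed

section \<open>Shifts and injectivity\<close>

lemma shift_code:
  assumes surj: "\<tau> ` X = X" and a: "\<tau> single_one a" and "x \<in> X"
  shows "\<tau> x = (\<lambda>j. x (j - a))"
proof -
  let ?\<sigma> = "\<lambda>x j. \<tau> x (j + a)"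
  interpret S: block_code B ?\<sigma> "\<bar>a\<bar> + N"
  proof unfold_locales
    fix x y assume xy: "x \<in> X" "y \<in> X" "\<And>j. \<bar>j\<bar> \<le> \<bar>a\<bar> + N \<Longrightarrow> x j = y j"
    show "\<tau> x (0 + a) = \<tau> y (0 + a)"
    proof (rule local_at[OF xy(1,2)])
      fix j assume "\<bar>j - (0 + a)\<bar> \<le> N"
      then show "x j = y j" by (intro xy(3)) linarith
    qed
  next
    fix x r assume "x \<in> X"
    then show "(\<lambda>j. \<tau> (\<lambda>j. x (j + r)) (j + a)) = (\<lambda>j. \<tau> x (j + r + a))"
      by (simp add: equivariant add.assoc add.commute[of r a])
  qed (intro maps X_translate)
  have "y \<in> ?\<sigma> ` X" if "y \<in> X" for y
  proof -
    have "(\<lambda>j. y (j + (- a))) \<in> \<tau> ` X" unfolding surj by (rule X_translate[OF that])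
    then obtain z where z: "z \<in> X" "\<tau> z = (\<lambda>j. y (j + (- a)))" by auto
    then have "?\<sigma> z = y" by simp
    then show ?thesis using z(1) by blast
  qed
  then have "?\<sigma> ` X = X" using S.maps by blast
  moreover have "m \<in> F" if C: "finite C" "C \<subseteq> F" "\<tau> (ind C) (m + a)" for C m
    unfolding free_integers_iff
  proof
    fix b assume b: "b \<in> B"
    obtain c where c: "\<And>m. m mod int b \<in> image_residues b \<longleftrightarrow> (m - c) mod int b \<in> residues b F"
      using image_residues_iff[OF surj b] by metis
    have zero: "ind {0} \<in> X"
      using X_translate[OF ind_X[of "{1}"], of 1] one_F by (simp add: ind_def)
    \<comment> \<open>A single one at \<open>q\<close> has an image with a one at
      \<open>q + a\<close>. So \<open>F + a\<close> lies in \<open>F + c\<close> modulo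
      \<open>b\<close>, which forces \<open>a\<close> and \<open>c\<close> to be congruent.\<close>
    have "(q + (a - c)) mod int b \<in> residues b F" if "q \<in> F" for q
    proof -
      have "\<tau> (ind {q}) (a + q)"
        using code_translate[OF zero, of q a] a by (simp add: ind_def single_one_def)
      then have "(a + q) mod int b \<in> image_residues b"
        using that by (intro image_residuesI[of "{q}"]) auto
      then show ?thesis unfolding c by (simp add: algebra_simps)
    qed
    then have "int b dvd a - c" by (rule period_dvd[OF b])
    moreover have "(m + a - c) mod int b \<in> residues b F"
      using image_residuesI[OF C] c by blast
    then have "\<not> int b dvd m + (a - c)" using residues_F_not_dvd[OF _ b] by (simp add: algebra_simps)
    ultimately show "\<not> int b dvd m" by (simp add: dvd_add_left_iff)
  qed
  ultimately have id: "?\<sigma> x = x" using S.code_eq_id[OF _ _ assms(3)] by blast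
  show ?thesis
  proof
    fix j
    show "\<tau> x j = x (j - a)" using fun_cong[OF id, of "j - a"] by simp
  qed
qed

text \<open>Since \<open>c\<close> depends on \<open>b\<close>, the image of a subset of
  \<open>F\<close> need not be a translate of one by a known amount. For each \<open>b\<close> the
  image is instead moved into \<open>F\<close> by some \<open>s\<close>, after enlarging it so much
  that \<open>s\<close> must be congruent to \<open>- c\<close>.\<close>

lemma surjective_imp_injective:
  assumes surj: "\<tau> ` X = X"
  shows "inj_on \<tau> X"
proof -
  let ?\<rho> = "\<lambda>x j. \<tau> (\<lambda>i. x (- i)) (- j)"
  interpret R: block_code B ?\<rho> N
  proof unfold_locales
    fix x r assume "x \<in> X"
    from equivariant[OF X_reflect[OF this], of "- r"]
    have "\<tau> (\<lambda>j. x (- j + r)) = (\<lambda>j. \<tau> (\<lambda>i. x (- i)) (j - r))" by simp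
    then show "(\<lambda>j. \<tau> (\<lambda>i. x (- i + r)) (- j)) = (\<lambda>j. \<tau> (\<lambda>i. x (- i)) (- (j + r)))"
      by (simp add: algebra_simps)
  next
    fix x y assume xy: "x \<in> X" "y \<in> X" "\<And>j. \<bar>j\<bar> \<le> N \<Longrightarrow> x j = y j"
    show "\<tau> (\<lambda>i. x (- i)) (- 0) = \<tau> (\<lambda>i. y (- i)) (- 0)"
    proof (rule local_at)
      fix j assume "\<bar>j - (- 0)\<bar> \<le> N"
      then show "x (- j) = y (- j)" by (intro xy(3)) linarith
    qed (intro X_reflect xy)+
  qed (intro X_reflect maps)
  interpret S: block_code B "\<lambda>x. ?\<rho> (\<tau> x)" "\<bar>N\<bar> + N"
  proof unfold_locales
    fix x y assume xy: "x \<in> X" "y \<in> X" "\<And>j. \<bar>j\<bar> \<le> \<bar>N\<bar> + N \<Longrightarrow> x j = y j"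
    show "?\<rho> (\<tau> x) 0 = ?\<rho> (\<tau> y) 0"
    proof (rule R.local_zero)
      fix j assume "\<bar>j\<bar> \<le> N"
      then show "\<tau> x j = \<tau> y j" by (intro local_at xy) auto
    qed (use xy maps in auto)
  qed (use R.maps R.equivariant maps equivariant in auto)
  have "?\<rho> ` X = X"
  proof
    show "X \<subseteq> ?\<rho> ` X"
    proof
      fix y assume "y \<in> X"
      then have "(\<lambda>j. y (- j)) \<in> \<tau> ` X" unfolding surj by (rule X_reflect)
      then obtain z where z: "z \<in> X" "\<tau> z = (\<lambda>j. y (- j))" by auto
      show "y \<in> ?\<rho> ` X" by (rule rev_image_eqI[OF X_reflect[OF z(1)]]) (simp add: z(2))
    qed
  qed (use R.maps in auto)
  then have "?\<rho> ` \<tau> ` X = X" unfolding surj .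
  then have "(\<lambda>x. ?\<rho> (\<tau> x)) ` X = X" unfolding image_image .
  moreover have "m \<in> F" if C: "finite C" "C \<subseteq> F" "?\<rho> (\<tau> (ind C)) m" for C m
    unfolding free_integers_iff
  proof
    fix b assume b: "b \<in> B"
    obtain c where c: "\<And>m. m mod int b \<in> image_residues b \<longleftrightarrow> (m - c) mod int b \<in> residues b F"
      using image_residues_iff[OF surj b] by metis
    \<comment> \<open>\<open>D\<close> reaches every class of \<open>F + c\<close> and leaves
      \<open>\<tau> (ind C)\<close> unchanged on the window that decides the value of
      \<open>?\<rho>\<close> at \<open>m\<close>.\<close>
    obtain D where D: "finite D" "D \<subseteq> F" "\<And>j. \<bar>j\<bar> \<le> \<bar>m\<bar> + \<bar>N\<bar> \<Longrightarrow> \<tau> (ind D) j = \<tau> (ind C) j"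
        "image_residues b \<subseteq> residues b {j. \<tau> (ind D) j}"
      using collect_image_residues[OF C(1,2) b finite_image_residues[OF b] order_refl] by metis
    define y where "y = \<tau> (ind D)"
    have y: "y \<in> X" unfolding y_def by (intro maps ind_X D)
    have "?\<rho> y m = ?\<rho> (\<tau> (ind C)) m"
    proof (rule R.local_at[OF y maps[OF ind_X[OF C(2)]]])
      fix j assume "\<bar>j - m\<bar> \<le> N"
      then show "y j = \<tau> (ind C) j" unfolding y_def by (intro D(3)) linarith
    qed
    then have ym: "?\<rho> y m" using C(3) by simp
    obtain W where W: "finite W" "W \<subseteq> {j. y j}" "residues b W = residues b {j. y j}"
      using finite_representatives[OF B_pos[OF b]] .
    \<comment> \<open>\<open>W\<close> carries the residues of \<open>y\<close> and
      \<open>?V\<close> the value of \<open>?\<rho> y\<close> at \<open>m\<close>; both must be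
      translated together.\<close>
    let ?V = "{j. \<bar>j\<bar> \<le> \<bar>m\<bar> + \<bar>N\<bar> \<and> y j}"
    have "?V \<subseteq> {- (\<bar>m\<bar> + \<bar>N\<bar>)..\<bar>m\<bar> + \<bar>N\<bar>}" by auto
    then have "finite ?V" by (rule finite_subset) simp
    then have P: "finite (W \<union> ?V)" using W(1) by simp
    have PX: "ind (W \<union> ?V) \<in> X" by (rule X_mono[OF y]) (use W(2) in \<open>auto simp: ind_def\<close>)
    obtain s where s: "(\<lambda>j. j + s) ` (W \<union> ?V) \<subseteq> F"
      by (rule pattern_occurs[OF y P]) (use W(2) in auto)
    have "?\<rho> (ind (W \<union> ?V)) m = ?\<rho> y m"
      by (rule R.local_at[OF PX y]) (use W(2) in \<open>auto simp: ind_def\<close>)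
    then have "?\<rho> (ind ((\<lambda>j. j + s) ` (W \<union> ?V))) (m + s)"
      using R.code_translate[OF PX, of s m] ym by simp
    moreover have "(\<lambda>i. ind A (- i)) = ind (uminus ` A)" for A
      by (auto simp: ind_def fun_eq_iff image_iff) (metis minus_minus)
    ultimately have img: "\<tau> (ind (uminus ` (\<lambda>j. j + s) ` (W \<union> ?V))) (- (m + s))" by simp
    have "- i \<in> F" if "i \<in> (\<lambda>j. j + s) ` (W \<union> ?V)" for i
      using subsetD[OF s that] by (simp only: free_integers_uminus)
    then have "uminus ` (\<lambda>j. j + s) ` (W \<union> ?V) \<subseteq> F" by blast
    \<comment> \<open>As \<open>F\<close> is symmetric, the reflected pattern is again a subset of
      \<open>F\<close>, so \<open>- (m + s)\<close> lies in \<open>F + c\<close> modulo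
      \<open>b\<close>; reflecting back puts \<open>m + s + c\<close> into \<open>F\<close>.\<close>
    then have "(- (m + s)) mod int b \<in> image_residues b"
      using img by (rule image_residuesI[OF finite_imageI[OF finite_imageI[OF P]]])
    then have "(m + (c + s)) mod int b \<in> residues b F"
      unfolding c using residues_F_uminus[of "- (m + s) - c" b] by (simp add: algebra_simps)
    then have "\<not> int b dvd m + (c + s)" by (rule residues_F_not_dvd[OF _ b])
    \<comment> \<open>\<open>W\<close> meets all classes of \<open>F + c\<close> and its translate
      by \<open>s\<close> lies in \<open>F\<close>, so \<open>c + s\<close> is a period of
      \<open>F\<close> modulo \<open>b\<close>.\<close>
    moreover have "(q + (c + s)) mod int b \<in> residues b F" if "q \<in> F" for q
    proof -
      have "(q + c) mod int b \<in> image_residues b"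
        unfolding c using that by (auto simp: residues_def)
      then have "(q + c) mod int b \<in> residues b W" using D(4) W(3) unfolding y_def by blast
      then obtain w where w: "w \<in> W" "(q + c) mod int b = w mod int b" by (auto simp: residues_def)
      then have "(q + c + s) mod int b = (w + s) mod int b" by (metis mod_add_left_eq)
      then show ?thesis using s w(1) by (auto simp: residues_def add.assoc)
    qed
    then have "int b dvd c + s" by (rule period_dvd[OF b])
    ultimately show "\<not> int b dvd m" by (simp add: dvd_add_left_iff)
  qed
  ultimately have id: "?\<rho> (\<tau> x) = x" if "x \<in> X" for x
    using S.code_eq_id[OF _ _ that] by blast
  show ?thesis
  proof (rule inj_onI)
    fix x y assume xy: "x \<in> X" "y \<in> X" "\<tau> x = \<tau> y"
    have "x = ?\<rho> (\<tau> x)" by (rule id[OF xy(1), symmetric])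
    also have "\<dots> = y" unfolding xy(3) by (rule id[OF xy(2)])
    finally show "x = y" .
  qed
qed

end

section \<open>From cellular automata to block codes\<close>

lemma (in hereditary_free_subshift) cellular_automaton_block_code:
  assumes "cellular_automaton X \<tau>"
  obtains N where "block_code B \<tau> N"
proof -
  have ca: "\<tau> ` X \<subseteq> X" "continuous_on X \<tau>" "\<And>x. x \<in> X \<Longrightarrow> \<tau> (\<lambda>j. x (j + 1)) = (\<lambda>j. \<tau> x (j + 1))"
    using assms unfolding cellular_automaton_def shift_def by auto
  have nat: "\<tau> (\<lambda>j. x (j + int n)) = (\<lambda>j. \<tau> x (j + int n))" if "x \<in> X" for x n
  proof (induction n)
    case (Suc n)
    have "\<tau> (\<lambda>j. x (j + 1 + int n)) = (\<lambda>j. \<tau> (\<lambda>j. x (j + int n)) (j + 1))"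
      using ca(3)[OF X_translate[OF that, of "int n"]] .
    then show ?case using Suc by (simp add: algebra_simps)
  qed simp
  have equi: "\<tau> (\<lambda>j. x (j + r)) = (\<lambda>j. \<tau> x (j + r))" if x: "x \<in> X" for x r
  proof (cases "r \<ge> 0")
    case True
    then show ?thesis using nat[OF x, of "nat r"] by simp
  next
    case False
    \<comment> \<open>Negative translations come from applying the forward case to the translated
      point.\<close>
    then have "\<tau> x = (\<lambda>j. \<tau> (\<lambda>j. x (j + r)) (j - r))"
      using nat[OF X_translate[OF x, of r], of "nat (- r)"] by simp
    from fun_cong[OF this] show ?thesis by simp
  qed
  have closed: "closed X" unfolding free_subshift_def by (rule closed_closure)
  obtain N where N: "\<And>x y. x \<in> X \<Longrightarrow> y \<in> X \<Longrightarrow> (\<And>j. \<bar>j\<bar> \<le> N \<Longrightarrow> x j = y j) \<Longrightarrow> \<tau> x 0 = \<tau> y 0"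
    using uniformly_local[OF closed ca(2)] by blast
  have "block_code B \<tau> N"
  proof unfold_locales
    show "\<tau> x \<in> X" if "x \<in> X" for x using that ca(1) by blast
    show "\<tau> (\<lambda>j. x (j + r)) = (\<lambda>j. \<tau> x (j + r))" if "x \<in> X" for x r by (rule equi[OF that])
    show "\<tau> x 0 = \<tau> y 0" if "x \<in> X" "y \<in> X" "\<And>j. \<bar>j\<bar> \<le> N \<Longrightarrow> x j = y j" for x y
      using that by (rule N)
  qed
  then show ?thesis by (rule that)
qed

theorem lemma6p5:
  fixes B :: "nat set"
  assumes "0 \<notin> B"
    and "primitive_set B"
    and "B \<noteq> {1}"
    and "hereditary (free_subshift B)"
  shows "(\<forall>\<tau>. cellular_automaton (free_subshift B) \<tau> \<longrightarrow> surjective_on (free_subshift B) \<tau> \<longrightarrow>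
            \<tau> single_one \<noteq> zero_seq \<longrightarrow>
            (\<exists>t::int. \<forall>x\<in>free_subshift B. \<tau> x = shift_power t x))
         \<and> moore_property (free_subshift B)"
proof -
  interpret hereditary_free_subshift B by unfold_locales (fact assms)+
  have "\<exists>t::int. \<forall>x\<in>X. \<tau> x = shift_power t x"
    if \<tau>: "cellular_automaton X \<tau>" "surjective_on X \<tau>" "\<tau> single_one \<noteq> zero_seq" for \<tau>
  proof -
    obtain N where "block_code B \<tau> N" using cellular_automaton_block_code[OF \<tau>(1)] .
    then interpret block_code B \<tau> N .
    obtain a where "\<tau> single_one a" using \<tau>(3) by (auto simp: zero_seq_def fun_eq_iff)
    \<comment> \<open>The sign is negative because \<open>shift\<close> moves ones to the left,
      whereas \<open>\<tau>\<close> carries the one at 0 to \<open>a\<close>.\<close>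
    then have "\<tau> x = shift_power (- a) x" if "x \<in> X" for x
      using shift_code[OF \<tau>(2)[unfolded surjective_on_def] _ that] by (simp add: shift_power_apply)
    then show ?thesis by blast
  qed
  moreover have "pre_injective X \<tau>" if \<tau>: "cellular_automaton X \<tau>" "surjective_on X \<tau>" for \<tau>
  proof -
    obtain N where "block_code B \<tau> N" using cellular_automaton_block_code[OF \<tau>(1)] .
    then interpret block_code B \<tau> N .
    \<comment> \<open>The Moore property also concerns automata that erase the single one, so it
      rests on the reflection argument.\<close>
    have "inj_on \<tau> X" using surjective_imp_injective \<tau>(2) unfolding surjective_on_def .
    then show ?thesis unfolding pre_injective_def inj_on_def by blast
  qed
  ultimately show ?thesis unfolding moore_property_def by blast
qed

end
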